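(* Let $f:U\to\mathbb{H}$ be a slice-regular function such that $|f|:U\to\mathbb{R}$ has a maximum in an (interior) point $q\in U$. Then $f$ is constant.
   Context: $\mathbb{H}$ is the algebra of quaternions with its Euclidean norm $|\cdot|$, $\mathbb{S}=\{q\in\mathbb{H}: q^2=-1\}$, and $\iota$ is the imaginary unit of $\mathbb{C}$. $\mathcal{U}\subset\mathbb{C}\cong\mathbb{R}^2$ is an open domain (connected) invariant under complex conjugation, and $U=\{x+vy: x+\iota y\in\mathcal{U},\ v\in\mathbb{S}\}$. A (left) slice-regular function on $U$ is $f:U\to\mathbb{H}$ with $f(x+vy)=\alpha(x,y)+v\beta(x,y)$ for all $x+\iota y\in\mathcal{U}$, $v\in\mathbb{S}$, where $\alpha,\beta:\mathcal{U}\to\mathbb{H}$ are differentiable with $\alpha(x,-y)=\alpha(x,y)$, $\beta(x,-y)=-\beta(x,y)$, $\partial_x\alpha=\partial_y\beta$, $\partial_y\alpha=-\partial_x\beta$. *)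

theory Defs
  imports "HOL-Analysis.Analysis"
begin

datatype quaternion = Quaternion (qRe: real) (qI: real) (qJ: real) (qK: real)

lemma quaternion_eq_iff:
  "p = q \<longleftrightarrow> qRe p = qRe q \<and> qI p = qI q \<and> qJ p = qJ q \<and> qK p = qK q"
  by (cases p; cases q) simp

instantiation quaternion :: ab_group_add
begin

definition zero_quaternion :: quaternion where
  "0 = Quaternion 0 0 0 0"

definition plus_quaternion :: "quaternion \<Rightarrow> quaternion \<Rightarrow> quaternion" where
  "p + q = Quaternion (qRe p + qRe q) (qI p + qI q) (qJ p + qJ q) (qK p + qK q)"

definition uminus_quaternion :: "quaternion \<Rightarrow> quaternion" where
  "- q = Quaternion (- qRe q) (- qI q) (- qJ q) (- qK q)"

definition minus_quaternion :: "quaternion \<Rightarrow> quaternion \<Rightarrow> quaternion" where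
  "p - q = Quaternion (qRe p - qRe q) (qI p - qI q) (qJ p - qJ q) (qK p - qK q)"

instance
  by standard
    (simp_all add: quaternion_eq_iff zero_quaternion_def plus_quaternion_def
      uminus_quaternion_def minus_quaternion_def)

end

lemma quaternion_zero_sel [simp]: "qRe 0 = 0" "qI 0 = 0" "qJ 0 = 0" "qK 0 = 0"
  by (simp_all add: zero_quaternion_def)

lemma quaternion_plus_sel [simp]:
  "qRe (p + q) = qRe p + qRe q" "qI (p + q) = qI p + qI q"
  "qJ (p + q) = qJ p + qJ q" "qK (p + q) = qK p + qK q"
  by (simp_all add: plus_quaternion_def)

lemma quaternion_uminus_sel [simp]:
  "qRe (- q) = - qRe q" "qI (- q) = - qI q" "qJ (- q) = - qJ q" "qK (- q) = - qK q"
  by (simp_all add: uminus_quaternion_def)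

lemma quaternion_minus_sel [simp]:
  "qRe (p - q) = qRe p - qRe q" "qI (p - q) = qI p - qI q"
  "qJ (p - q) = qJ p - qJ q" "qK (p - q) = qK p - qK q"
  by (simp_all add: minus_quaternion_def)

instantiation quaternion :: ring_1
begin

definition one_quaternion :: quaternion where
  "1 = Quaternion 1 0 0 0"

definition times_quaternion :: "quaternion \<Rightarrow> quaternion \<Rightarrow> quaternion" where
  "p * q = Quaternion
     (qRe p * qRe q - qI p * qI q - qJ p * qJ q - qK p * qK q)
     (qRe p * qI q + qI p * qRe q + qJ p * qK q - qK p * qJ q)
     (qRe p * qJ q - qI p * qK q + qJ p * qRe q + qK p * qI q)
     (qRe p * qK q + qI p * qJ q - qJ p * qI q + qK p * qRe q)"

instance
  by standard
    (simp_all add: quaternion_eq_iff one_quaternion_def times_quaternion_def algebra_simps)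

end

lemma quaternion_one_sel [simp]: "qRe 1 = 1" "qI 1 = 0" "qJ 1 = 0" "qK 1 = 0"
  by (simp_all add: one_quaternion_def)

lemma quaternion_times_sel [simp]:
  "qRe (p * q) = qRe p * qRe q - qI p * qI q - qJ p * qJ q - qK p * qK q"
  "qI (p * q) = qRe p * qI q + qI p * qRe q + qJ p * qK q - qK p * qJ q"
  "qJ (p * q) = qRe p * qJ q - qI p * qK q + qJ p * qRe q + qK p * qI q"
  "qK (p * q) = qRe p * qK q + qI p * qJ q - qJ p * qI q + qK p * qRe q"
  by (simp_all add: times_quaternion_def)

instantiation quaternion :: real_algebra_1
begin

definition scaleR_quaternion :: "real \<Rightarrow> quaternion \<Rightarrow> quaternion" where
  "r *\<^sub>R q = Quaternion (r * qRe q) (r * qI q) (r * qJ q) (r * qK q)"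

instance
  by standard (simp_all add: quaternion_eq_iff scaleR_quaternion_def algebra_simps)

end

lemma quaternion_scaleR_sel [simp]:
  "qRe (r *\<^sub>R q) = r * qRe q" "qI (r *\<^sub>R q) = r * qI q"
  "qJ (r *\<^sub>R q) = r * qJ q" "qK (r *\<^sub>R q) = r * qK q"
  by (simp_all add: scaleR_quaternion_def)

lemma quaternion_of_real_sel [simp]:
  "qRe (of_real r) = r" "qI (of_real r) = 0" "qJ (of_real r) = 0" "qK (of_real r) = 0"
  by (simp_all add: of_real_def)

instantiation quaternion :: real_inner
begin

definition inner_quaternion :: "quaternion \<Rightarrow> quaternion \<Rightarrow> real" where
  "p \<bullet> q = qRe p * qRe q + qI p * qI q + qJ p * qJ q + qK p * qK q"

definition norm_quaternion :: "quaternion \<Rightarrow> real" where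
  "norm q = sqrt ((qRe q)\<^sup>2 + (qI q)\<^sup>2 + (qJ q)\<^sup>2 + (qK q)\<^sup>2)"

definition sgn_quaternion :: "quaternion \<Rightarrow> quaternion" where
  "sgn (q :: quaternion) = q /\<^sub>R norm q"

definition dist_quaternion :: "quaternion \<Rightarrow> quaternion \<Rightarrow> real" where
  "dist (p :: quaternion) q = norm (p - q)"

definition uniformity_quaternion :: "(quaternion \<times> quaternion) filter" where
  "uniformity = (INF e\<in>{0<..}. principal {(p :: quaternion, q). dist p q < e})"

definition open_quaternion :: "quaternion set \<Rightarrow> bool" where
  "open (S :: quaternion set) \<longleftrightarrow>
     (\<forall>p\<in>S. \<forall>\<^sub>F (p', q) in uniformity. p' = p \<longrightarrow> q \<in> S)"

instance
proof
  fix p q r :: quaternion and a :: real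
  show "p \<bullet> q = q \<bullet> p" "(p + q) \<bullet> r = p \<bullet> r + q \<bullet> r" "(a *\<^sub>R p) \<bullet> q = a * (p \<bullet> q)"
    by (simp_all add: inner_quaternion_def algebra_simps)
  show "0 \<le> p \<bullet> p" by (simp add: inner_quaternion_def)
  show "p \<bullet> p = 0 \<longleftrightarrow> p = 0"
    by (simp add: inner_quaternion_def quaternion_eq_iff add_nonneg_eq_0_iff)
  show "norm p = sqrt (p \<bullet> p)"
    by (simp add: norm_quaternion_def inner_quaternion_def power2_eq_square)
qed (fact dist_quaternion_def sgn_quaternion_def uniformity_quaternion_def open_quaternion_def)+

end

instantiation quaternion :: euclidean_space
begin

definition Basis_quaternion :: "quaternion set" where
  "Basis = {Quaternion 1 0 0 0, Quaternion 0 1 0 0, Quaternion 0 0 1 0, Quaternion 0 0 0 1}"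

instance
proof
  show "finite (Basis :: quaternion set)" "(Basis :: quaternion set) \<noteq> {}"
    by (simp_all add: Basis_quaternion_def)
  fix u v :: quaternion
  show "u \<in> Basis \<Longrightarrow> v \<in> Basis \<Longrightarrow> u \<bullet> v = (if u = v then 1 else 0)"
    unfolding Basis_quaternion_def inner_quaternion_def by fastforce
  show "(\<forall>v\<in>Basis. u \<bullet> v = 0) \<longleftrightarrow> u = 0"
    by (simp add: Basis_quaternion_def inner_quaternion_def quaternion_eq_iff [of u])
qed

end

instantiation quaternion :: real_normed_div_algebra
begin

definition inverse_quaternion :: "quaternion \<Rightarrow> quaternion" where
  "inverse q = Quaternion (qRe q) (- qI q) (- qJ q) (- qK q) /\<^sub>R (norm q)\<^sup>2"

definition divide_quaternion :: "quaternion \<Rightarrow> quaternion \<Rightarrow> quaternion" where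
  "(p :: quaternion) div q = p * inverse q"

instance
proof
  fix p q :: quaternion
  show "p div q = p * inverse q" by (fact divide_quaternion_def)
  show "inverse (0 :: quaternion) = 0" by (simp add: inverse_quaternion_def)
  have sq: "(norm x)\<^sup>2 = (qRe x)\<^sup>2 + (qI x)\<^sup>2 + (qJ x)\<^sup>2 + (qK x)\<^sup>2" for x :: quaternion
    by (simp add: norm_quaternion_def)
  have "(norm (p * q))\<^sup>2 = (norm p * norm q)\<^sup>2"
    unfolding power_mult_distrib sq quaternion_times_sel by algebra
  then show "norm (p * q) = norm p * norm q"
    by simp
  assume "q \<noteq> 0"
  then have nz: "(norm q)\<^sup>2 \<noteq> 0" by simp
  have conj: "Quaternion (qRe q) (- qI q) (- qJ q) (- qK q) * q = of_real ((norm q)\<^sup>2)"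
    "q * Quaternion (qRe q) (- qI q) (- qJ q) (- qK q) = of_real ((norm q)\<^sup>2)"
    unfolding sq by (simp_all add: quaternion_eq_iff power2_eq_square del: of_real_power of_real_add)
  show "inverse q * q = 1" "q * inverse q = 1"
    unfolding inverse_quaternion_def mult_scaleR_left mult_scaleR_right conj
    using nz by (simp_all add: of_real_def)
qed

end

definition imag_unit_sphere :: "quaternion set" where
  "imag_unit_sphere = {q. q\<^sup>2 = - 1}"

definition slice_point :: "quaternion \<Rightarrow> complex \<Rightarrow> quaternion" where
  "slice_point v z = of_real (Re z) + v * of_real (Im z)"

definition circularization :: "complex set \<Rightarrow> quaternion set" where
  "circularization D = {slice_point v z | v z. v \<in> imag_unit_sphere \<and> z \<in> D}"

definition partial_x :: "(complex \<Rightarrow> 'a::real_normed_vector) \<Rightarrow> complex \<Rightarrow> 'a" where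
  "partial_x g z = vector_derivative (\<lambda>t. g (Complex t (Im z))) (at (Re z))"

definition partial_y :: "(complex \<Rightarrow> 'a::real_normed_vector) \<Rightarrow> complex \<Rightarrow> 'a" where
  "partial_y g z = vector_derivative (\<lambda>t. g (Complex (Re z) t)) (at (Im z))"

text \<open>
  Only the values on \<^term>\<open>circularization D\<close> are constrained.  The domain of the components is
  viewed as a subset of the real plane, so their differentiability is real (Frechet)
  differentiability; for open \<open>D\<close> it is differentiability at every point.
\<close>

definition slice_regular :: "complex set \<Rightarrow> (quaternion \<Rightarrow> quaternion) \<Rightarrow> bool" where
  "slice_regular D f \<longleftrightarrow>
     (\<exists>\<alpha> \<beta> :: complex \<Rightarrow> quaternion.
        (\<forall>z\<in>D. \<forall>v\<in>imag_unit_sphere. f (slice_point v z) = \<alpha> z + v * \<beta> z) \<and>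
        \<alpha> differentiable_on D \<and> \<beta> differentiable_on D \<and>
        (\<forall>z\<in>D. \<alpha> (cnj z) = \<alpha> z \<and> \<beta> (cnj z) = - \<beta> z \<and>
               partial_x \<alpha> z = partial_y \<beta> z \<and> partial_y \<alpha> z = - partial_x \<beta> z))"

end

theory Submission
  imports Defs "HOL-Complex_Analysis.Conformal_Mappings"
begin

text \<open>
  Let the maximum be attained at \<open>q = slice_point v w\<close> and put \<open>c = f q\<close>. On the slice spanned
  by \<open>1\<close> and \<open>v\<close> the function becomes \<open>F = \<alpha> + v * \<beta>\<close>, and the Cauchy--Riemann equations for
  \<open>\<alpha>\<close> and \<open>\<beta>\<close> say exactly that \<open>F\<close> is holomorphic for the complex structure that left
  multiplication by \<open>v\<close> puts on the quaternions. To use the scalar maximum principle, \<open>F\<close> is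
  composed with the complex-linear functional \<open>L\<close> whose real part is the inner product with \<open>c\<close>.
  By Cauchy--Schwarz, \<open>Re (L (F z)) = F z \<bullet> c\<close> is largest at \<open>w\<close>, where it is the square of
  \<open>norm c\<close>, so \<open>exp \<circ> L \<circ> F\<close> has constant modulus and \<open>F z \<bullet> c = c \<bullet> c\<close> throughout. Together
  with \<open>norm (F z) \<le> norm c\<close> this is the equality case of Cauchy--Schwarz, hence \<open>F = c\<close>.

  This settles only one slice. It carries over to all the others because \<open>\<alpha>\<close> is even and \<open>\<beta>\<close> is
  odd under conjugation: comparing \<open>F\<close> at \<open>z\<close> and \<open>cnj z\<close> gives \<open>\<alpha> + v * \<beta> = c = \<alpha> - v * \<beta>\<close>,
  so \<open>\<beta> = 0\<close> and \<open>\<alpha> = c\<close>.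
\<close>

text \<open>
  The components of \<open>v\<^sup>2 = - 1\<close> along \<open>i\<close>, \<open>j\<close>, \<open>k\<close> are the products of \<open>2 * qRe v\<close> with those of
  \<open>v\<close>; a nonzero real part would make \<open>v\<close> real, with a nonnegative square.
\<close>

lemma imag_unit_qRe_eq_0:
  assumes "v \<in> imag_unit_sphere"
  shows "qRe v = 0"
proof (rule ccontr)
  assume nz: "qRe v \<noteq> 0"
  have sq: "v * v = - 1"
    using assms by (simp add: imag_unit_sphere_def power2_eq_square)
  from sq nz have "qI v = 0" "qJ v = 0" "qK v = 0"
    by (simp_all add: quaternion_eq_iff)
  with sq have "qRe v * qRe v = - 1"
    by (simp add: quaternion_eq_iff)
  then show False
    by (smt (verit) zero_le_square)
qed

lemma imag_unit_mult_imag_unit: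
  assumes "v \<in> imag_unit_sphere"
  shows "v * (v * x) = - x"
proof -
  have "v * v = - 1"
    using assms by (simp add: imag_unit_sphere_def power2_eq_square)
  then show ?thesis
    by (simp flip: mult.assoc)
qed

lemma inner_imag_unit_mult_left:
  assumes "v \<in> imag_unit_sphere"
  shows "(v * x) \<bullet> y = - (x \<bullet> (v * y))"
  using imag_unit_qRe_eq_0[OF assms] by (simp add: inner_quaternion_def algebra_simps)

text \<open>
  Left multiplication by \<open>v\<close> is skew-adjoint with square \<open>- 1\<close>, so this real-linear functional is
  complex-linear once \<open>v\<close> acts as \<open>\<i>\<close>.
\<close>

definition slice_functional :: "quaternion \<Rightarrow> quaternion \<Rightarrow> quaternion \<Rightarrow> complex" where
  "slice_functional v c x = of_real (x \<bullet> c) + \<i> * of_real (x \<bullet> (v * c))"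

lemma Re_slice_functional [simp]: "Re (slice_functional v c x) = x \<bullet> c"
  by (simp add: slice_functional_def)

lemma bounded_linear_slice_functional: "bounded_linear (slice_functional v c)"
  unfolding slice_functional_def
  by (intro bounded_linear_add bounded_linear_const_mult
      bounded_linear_compose[OF bounded_linear_of_real] bounded_linear_inner_left)

lemma slice_functional_imag_unit_mult:
  assumes "v \<in> imag_unit_sphere"
  shows "slice_functional v c (v * x) = \<i> * slice_functional v c x"
  using inner_imag_unit_mult_left[OF assms] imag_unit_mult_imag_unit[OF assms]
  by (simp add: slice_functional_def complex_eq_iff)

lemma partial_x_eq_derivative:
  assumes "(g has_derivative g') (at z)"
  shows "partial_x g z = g' 1"
proof -
  have "((\<lambda>t. Complex t (Im z)) has_vector_derivative 1) (at (Re z))"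
    unfolding Complex_eq by (auto intro!: derivative_eq_intros)
  moreover have "(g has_derivative g') (at (Complex (Re z) (Im z)) within range (\<lambda>t. Complex t (Im z)))"
    using assms by (simp add: has_derivative_at_withinI)
  ultimately have "(g \<circ> (\<lambda>t. Complex t (Im z)) has_vector_derivative g' 1) (at (Re z))"
    by (rule vector_derivative_diff_chain_within)
  then show ?thesis
    unfolding partial_x_def o_def by (rule vector_derivative_at)
qed

lemma partial_y_eq_derivative:
  assumes "(g has_derivative g') (at z)"
  shows "partial_y g z = g' \<i>"
proof -
  have "((\<lambda>t. Complex (Re z) t) has_vector_derivative \<i>) (at (Im z))"
    unfolding Complex_eq by (auto intro!: derivative_eq_intros)
  moreover have "(g has_derivative g') (at (Complex (Re z) (Im z)) within range (\<lambda>t. Complex (Re z) t))"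
    using assms by (simp add: has_derivative_at_withinI)
  ultimately have "(g \<circ> (\<lambda>t. Complex (Re z) t) has_vector_derivative g' \<i>) (at (Im z))"
    by (rule vector_derivative_diff_chain_within)
  then show ?thesis
    unfolding partial_y_def o_def by (rule vector_derivative_at)
qed

lemma real_linear_imp_complex_linear:
  fixes T :: "complex \<Rightarrow> complex"
  assumes "linear T" and "T \<i> = \<i> * T 1"
  shows "T = (*) (T 1)"
proof
  fix h :: complex
  have "h = Re h *\<^sub>R 1 + Im h *\<^sub>R \<i>"
    by (simp add: complex_eq_iff)
  then have "T h = Re h *\<^sub>R T 1 + Im h *\<^sub>R T \<i>"
    by (metis assms(1) linear_add linear_scale)
  also have "\<dots> = (Re h *\<^sub>R 1 + Im h *\<^sub>R \<i>) * T 1"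
    by (simp add: assms(2) scaleR_conv_of_real algebra_simps)
  also have "Re h *\<^sub>R 1 + Im h *\<^sub>R \<i> = h"
    by (simp add: complex_eq_iff)
  finally show "T h = T 1 * h"
    by (simp add: mult.commute)
qed

text \<open>
  The Cauchy--Riemann equations turn the derivative of \<open>\<alpha> + v * \<beta>\<close> into a map that sends
  \<open>\<i>\<close> to \<open>v\<close> times its value at \<open>1\<close>, and the functional replaces this \<open>v\<close> by \<open>\<i>\<close>.
\<close>

lemma slice_functional_holomorphic:
  assumes "open D" and v: "v \<in> imag_unit_sphere"
    and diff: "\<alpha> differentiable_on D" "\<beta> differentiable_on D"
    and cr: "\<And>z. z \<in> D \<Longrightarrow> partial_x \<alpha> z = partial_y \<beta> z"
      "\<And>z. z \<in> D \<Longrightarrow> partial_y \<alpha> z = - partial_x \<beta> z"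
  shows "(\<lambda>z. slice_functional v c (\<alpha> z + v * \<beta> z)) holomorphic_on D"
  unfolding holomorphic_on_open[OF \<open>open D\<close>]
proof (intro ballI)
  fix z assume z: "z \<in> D"
  obtain A B where A: "(\<alpha> has_derivative A) (at z)" and B: "(\<beta> has_derivative B) (at z)"
    using diff z \<open>open D\<close>
    by (metis differentiable_def differentiable_on_def at_within_open)
  define G where "G = (\<lambda>h. A h + v * B h)"
  define T where "T = (\<lambda>h. slice_functional v c (G h))"
  have "((\<lambda>z. \<alpha> z + v * \<beta> z) has_derivative G) (at z)"
    unfolding G_def
    by (intro has_derivative_add A bounded_linear.has_derivative[OF bounded_linear_mult_right B])
  then have T: "((\<lambda>z. slice_functional v c (\<alpha> z + v * \<beta> z)) has_derivative T) (at z)"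
    unfolding T_def
    by (rule bounded_linear.has_derivative[OF bounded_linear_slice_functional])
  have "A 1 = B \<i>" "A \<i> = - B 1"
    using cr[OF z] partial_x_eq_derivative[OF A] partial_x_eq_derivative[OF B]
      partial_y_eq_derivative[OF A] partial_y_eq_derivative[OF B] by simp_all
  then have "G \<i> = v * G 1"
    by (simp add: G_def distrib_left imag_unit_mult_imag_unit[OF v])
  then have "T \<i> = \<i> * T 1"
    by (simp add: T_def slice_functional_imag_unit_mult[OF v])
  then have "T = (*) (T 1)"
    using real_linear_imp_complex_linear has_derivative_linear[OF T] by blast
  then show "\<exists>d. ((\<lambda>z. slice_functional v c (\<alpha> z + v * \<beta> z)) has_field_derivative d) (at z)"
    using T unfolding has_field_derivative_def by metis
qed

text \<open>Exponentiating turns a bound on the real part into one on the modulus.\<close>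

lemma maximum_real_part_principle:
  assumes "g holomorphic_on D" "open D" "connected D" "w \<in> D"
    and "\<And>z. z \<in> D \<Longrightarrow> Re (g z) \<le> Re (g w)" and "z \<in> D"
  shows "Re (g z) = Re (g w)"
proof -
  have "(\<lambda>z. exp (g z)) constant_on D"
    by (rule maximum_modulus_principle[where U = D and \<xi> = w])
      (use assms in \<open>auto intro: holomorphic_intros\<close>)
  then have "exp (g z) = exp (g w)"
    using assms by (auto simp: constant_on_def)
  then have "exp (Re (g z)) = exp (Re (g w))"
    by (metis norm_exp_eq_Re)
  then show ?thesis
    by simp
qed

lemma eq_if_inner_eq_norm_le:
  fixes x c :: "'a::real_inner"
  assumes "x \<bullet> c = c \<bullet> c" "norm x \<le> norm c"
  shows "x = c"
proof -
  have "x \<bullet> x \<le> c \<bullet> c"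
    using assms(2) by (simp add: norm_le)
  then have "(x - c) \<bullet> (x - c) \<le> 0"
    using assms(1) by (simp add: inner_diff_left inner_diff_right inner_commute)
  then show ?thesis
    by (metis eq_iff_diff_eq_0 inner_eq_zero_iff inner_ge_zero order_antisym)
qed

theorem theorem7p2:
  fixes D :: "complex set" and f :: "quaternion \<Rightarrow> quaternion" and q :: quaternion
  assumes "open D" and "connected D" and "\<And>z. z \<in> D \<Longrightarrow> cnj z \<in> D"
    and "slice_regular D f"
    and "q \<in> interior (circularization D)"
    and "\<And>p. p \<in> circularization D \<Longrightarrow> norm (f p) \<le> norm (f q)"
  shows "f constant_on circularization D"
proof -
  obtain \<alpha> \<beta> where f: "\<And>z u. z \<in> D \<Longrightarrow> u \<in> imag_unit_sphere \<Longrightarrow> f (slice_point u z) = \<alpha> z + u * \<beta> z"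
    and diff: "\<alpha> differentiable_on D" "\<beta> differentiable_on D"
    and par: "\<And>z. z \<in> D \<Longrightarrow> \<alpha> (cnj z) = \<alpha> z" "\<And>z. z \<in> D \<Longrightarrow> \<beta> (cnj z) = - \<beta> z"
    and cr: "\<And>z. z \<in> D \<Longrightarrow> partial_x \<alpha> z = partial_y \<beta> z"
      "\<And>z. z \<in> D \<Longrightarrow> partial_y \<alpha> z = - partial_x \<beta> z"
    using assms(4) unfolding slice_regular_def by blast
  obtain v w where v: "v \<in> imag_unit_sphere" and w: "w \<in> D" and q: "q = slice_point v w"
    using assms(5) interior_subset by (fastforce simp: circularization_def)
  define F where "F = (\<lambda>z. \<alpha> z + v * \<beta> z)"
  define c where "c = f q"
  have Fw: "F w = c"
    by (simp add: F_def c_def q f v w)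
  have le: "norm (F z) \<le> norm c" if "z \<in> D" for z
    using assms(6)[of "slice_point v z"] that v f[OF that v]
    by (auto simp: F_def c_def circularization_def)
  have Re_le: "F z \<bullet> c \<le> F w \<bullet> c" if "z \<in> D" for z
  proof -
    have "F z \<bullet> c \<le> norm (F z) * norm c"
      by (rule norm_cauchy_schwarz)
    also have "\<dots> \<le> norm c * norm c"
      using le[OF that] by (simp add: mult_right_mono)
    finally show ?thesis
      by (simp add: Fw norm_eq_sqrt_inner)
  qed
  have "(\<lambda>z. slice_functional v c (F z)) holomorphic_on D"
    unfolding F_def by (rule slice_functional_holomorphic) (use assms(1) v diff cr in auto)
  then have "F z \<bullet> c = F w \<bullet> c" if "z \<in> D" for z
    using maximum_real_part_principle[of "\<lambda>z. slice_functional v c (F z)" D w z]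
      assms(1,2) w that Re_le by simp
  then have F: "F z = c" if "z \<in> D" for z
    using eq_if_inner_eq_norm_le le Fw that by metis
  have \<beta>: "\<beta> z = 0" if z: "z \<in> D" for z
  proof -
    have "\<alpha> z + v * \<beta> z = \<alpha> z - v * \<beta> z"
      using F[OF z] F[OF assms(3)[OF z]] par[OF z] by (simp add: F_def)
    then have "v * \<beta> z + v * \<beta> z = 0"
      by (simp add: algebra_simps)
    then have "v * \<beta> z = 0"
      by (simp flip: scaleR_2)
    then show ?thesis
      using imag_unit_mult_imag_unit[OF v, of "\<beta> z"] by auto
  qed
  have "\<alpha> z = c" if "z \<in> D" for z
    using F[OF that] \<beta>[OF that] by (simp add: F_def)
  then have "f p = c" if "p \<in> circularization D" for p
    using that f \<beta> by (auto simp: circularization_def)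
  then show ?thesis
    by (auto simp: constant_on_def)
qed

end
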